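(* Let $s=q_1,\ldots,q_n$ be a non-leaping sequence, let $W_1,\ldots,W_n$ be any neighborhood sequence of $s$ (with associated $a_k$), let $G$ be the corresponding graph and $\mathcal{D}$ its distance matrix, and let $E$ be the reducing matrix of this neighborhood sequence. Then $E^\top\mathcal{D}E$ equals the weighted adjacency matrix $A$ of the reduced graph of $s$. In particular, $E^\top \mathcal{D} E$ does not depend on the choice of the neighborhood sequence.
   Context: A sequence of integers $q_1,\ldots,q_n$ ($n\ge 2$) is non-leaping if $q_1=0$, $q_2=1$, and $2\le q_k\le q_{k-1}+1$ for $k=3,\ldots,n$. Set $b_k=k-q_k+1$ for $k\ge 3$, and $a_2=1$, $b_2=2$. A neighborhood sequence of $s$ is a sequence of sets $W_1=\varnothing$, $W_2=\{1\}$, and for $k\ge3$, $W_k=\{a_k\}\cup\{b_k,b_k+1,\ldots,k-1\}$ where $a_k\in W_{k-1}$ and $a_k<b_k$ (so $|W_k|=q_k$). The corresponding graph has vertex set $\{1,\ldots,n\}$ and, for each $k$, vertex $k$ is joined to every vertex of $W_k$ (these are all the edges). The distance matrix is $\mathcal{D}=[\operatorname{dist}_G(i,j)]$. The reducing matrix $E$ is the $n\times n$ matrix whose $k$-th column is ${\bf e}_k$ for $k\in\{1,2\}$ and ${\bf e}_k-{\bf e}_{a_k}-{\bf e}_{k-1}+{\bf e}_{a_{k-1}}$ for $k\ge3$, where ${\bf e}_i$ are standard basis vectors. The weighted adjacency matrix $A=[A_{i,j}]$ of the reduced graph of $s$ is the symmetric $n\times n$ matrix with $A_{1,1}=A_{2,2}=0$,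 $A_{k,k}=-2$ for $k\ge3$, $A_{1,2}=A_{2,1}=1$, and for $k\ge 3$ and $i<k$, $A_{i,k}=A_{k,i}=[i=b_{k-1}]-[i=b_k]+[i=k-1]$, where $[P]$ is $1$ if $P$ holds and $0$ otherwise. *)

theory Defs
  imports "Jordan_Normal_Form.Matrix" "Graph_Theory.Graph_Theory"
begin

text \<open>Sequences are functions on \<^typ>\<open>nat\<close> of which only the values at \<open>1, \<dots>, n\<close> matter. The terms of
  a non-leaping sequence are nonnegative, so they are taken in \<^typ>\<open>nat\<close>.\<close>

definition non_leaping :: "nat \<Rightarrow> (nat \<Rightarrow> nat) \<Rightarrow> bool" where
  "non_leaping n q \<longleftrightarrow>
     n \<ge> 2 \<and> q 1 = 0 \<and> q 2 = 1 \<and> (\<forall>k\<in>{3..n}. 2 \<le> q k \<and> q k \<le> q (k - 1) + 1)"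

text \<open>Written as \<open>k + 1 - q k\<close>, the subtraction does not truncate: a non-leaping
  sequence satisfies \<open>q k < k\<close>.\<close>

definition bval :: "(nat \<Rightarrow> nat) \<Rightarrow> nat \<Rightarrow> nat" where
  "bval q k = (if k = 2 then 2 else k + 1 - q k)"

definition neighborhood_sequence ::
  "nat \<Rightarrow> (nat \<Rightarrow> nat) \<Rightarrow> (nat \<Rightarrow> nat set) \<Rightarrow> (nat \<Rightarrow> nat) \<Rightarrow> bool" where
  "neighborhood_sequence n q W a \<longleftrightarrow>
     W 1 = {} \<and> W 2 = {1} \<and> a 2 = 1 \<and>
     (\<forall>k\<in>{3..n}. a k \<in> W (k - 1) \<and> a k < bval q k \<and> W k = {a k} \<union> {bval q k..<k})"

text \<open>An undirected graph is a digraph with a symmetric set of arcs.\<close>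

definition nbr_graph :: "nat \<Rightarrow> (nat \<Rightarrow> nat set) \<Rightarrow> nat pair_pre_digraph" where
  "nbr_graph n W = \<lparr> pverts = {1..n},
     parcs = {(u, k). k \<in> {1..n} \<and> u \<in> W k} \<union> {(k, u). k \<in> {1..n} \<and> u \<in> W k} \<rparr>"

text \<open>The distance of two vertices is the least cost of a walk between them, every arc costing 1.\<close>

definition graph_dist :: "'a pair_pre_digraph \<Rightarrow> 'a \<Rightarrow> 'a \<Rightarrow> ereal" where
  "graph_dist G u v = wf_digraph.\<mu> (with_proj G) (\<lambda>_. 1) u v"

text \<open>Rows and columns of matrices are numbered from 0, vertices from 1. The graphs considered here
  are connected, so \<^const>\<open>real_of_ereal\<close> is only applied to finite distances.\<close>

definition dist_matrix :: "nat \<Rightarrow> nat pair_pre_digraph \<Rightarrow> real mat" where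
  "dist_matrix n G = mat n n (\<lambda>(i, j). real_of_ereal (graph_dist G (Suc i) (Suc j)))"

definition std_vec :: "nat \<Rightarrow> nat \<Rightarrow> real vec" where
  "std_vec n i = unit_vec n (i - 1)"

definition reducing_matrix :: "nat \<Rightarrow> (nat \<Rightarrow> nat) \<Rightarrow> real mat" where
  "reducing_matrix n a = mat_of_cols n (map (\<lambda>k.
     if k \<le> 2 then std_vec n k
     else std_vec n k - std_vec n (a k) - std_vec n (k - 1) + std_vec n (a (k - 1))) [1..<Suc n])"

definition upper_weight :: "(nat \<Rightarrow> nat) \<Rightarrow> nat \<Rightarrow> nat \<Rightarrow> real" where
  "upper_weight q i k = (if k = 2 then 1
     else of_bool (i = bval q (k - 1)) - of_bool (i = bval q k) + of_bool (i = k - 1))"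

definition reduced_weight :: "(nat \<Rightarrow> nat) \<Rightarrow> nat \<Rightarrow> nat \<Rightarrow> real" where
  "reduced_weight q i j =
     (if i = j then (if i \<le> 2 then 0 else -2) else upper_weight q (min i j) (max i j))"

definition reduced_adj_matrix :: "nat \<Rightarrow> (nat \<Rightarrow> nat) \<Rightarrow> real mat" where
  "reduced_adj_matrix n q = mat n n (\<lambda>(i, j). reduced_weight q (Suc i) (Suc j))"

lemma nbr_graph_pair_graph:
  assumes "non_leaping n q" "neighborhood_sequence n q W a"
  shows "pair_graph (nbr_graph n W)"
proof -
  have W: "W k \<subseteq> {1..<k}" if "k \<in> {1..n}" for k
    using that
  proof (induction k rule: less_induct)
    case (less k)
    consider "k = 1" | "k = 2" | "k \<ge> 3" using less.prems by fastforce
    then show ?case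
    proof cases
      case 3
      have k: "k \<in> {3..n}" using 3 less.prems by simp
      have "q j < j" if "j \<in> {1..n}" for j
        using that
      proof (induction j rule: less_induct)
        case (less j)
        consider "j = 1" | "j = 2" | "j \<ge> 3" using less.prems by fastforce
        then show ?case
        proof cases
          case 3
          then have "q (j - 1) < j - 1" "q j \<le> q (j - 1) + 1"
            using less assms(1) by (auto simp: non_leaping_def)
          then show ?thesis by linarith
        qed (use assms(1) in \<open>auto simp: non_leaping_def\<close>)
      qed
      then have b: "1 \<le> bval q k" using less.prems by (force simp: bval_def)
      have "W (k - 1) \<subseteq> {1..<k - 1}" using k by (intro less.IH) auto
      moreover have "a k \<in> W (k - 1)" "W k = {a k} \<union> {bval q k..<k}"
        using assms(2) k unfolding neighborhood_sequence_def by blast+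
      ultimately have "a k \<in> {1..<k - 1}" "W k = {a k} \<union> {bval q k..<k}" by blast+
      then show ?thesis using b by auto
    qed (use assms(2) in \<open>auto simp: neighborhood_sequence_def\<close>)
  qed
  show ?thesis
  proof
    show "finite (parcs (nbr_graph n W))"
      by (rule finite_subset[of _ "{1..n} \<times> {1..n}"])
         (use W in \<open>fastforce simp: nbr_graph_def\<close>)+
    show "symmetric (with_proj (nbr_graph n W))"
      by (auto simp: nbr_graph_def symmetric_def arcs_ends_def arc_to_ends_def intro!: symI)
  qed (use W in \<open>fastforce simp: nbr_graph_def\<close>)+
qed

end

theory Submission
  imports Defs
begin

text \<open>Every \<open>W k\<close> is a clique, so adding vertex \<open>k\<close> does not change earlier distances, and for
  \<open>u < v\<close> the distance is 1 if \<open>b v \<le> u\<close> and one more than the distance from \<open>u\<close> to \<open>a v\<close>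
  otherwise. Hence \<open>dist(k, j) - dist(a k, j)\<close>, for \<open>j \<le> k\<close>, is \<open>[j < b k] - [j = k]\<close>, in which
  only \<open>b\<close> appears. Column \<open>k\<close> of the product of \<open>D\<close> and \<open>E\<close> is the difference of these vectors for
  \<open>k\<close> and \<open>k - 1\<close>; above the diagonal it vanishes at every \<open>a i\<close> with \<open>i < k\<close>, so the rows of the
  transpose of \<open>E\<close> merely take its consecutive differences.\<close>

text \<open>The second disjunct of the middle case never applies to a neighborhood sequence; it makes the
  recursion terminate for arbitrary \<open>a\<close>.\<close>

function nbr_dist :: "(nat \<Rightarrow> nat) \<Rightarrow> (nat \<Rightarrow> nat) \<Rightarrow> nat \<Rightarrow> nat \<Rightarrow> nat" where
  "nbr_dist b a u v =
     (if u = v then 0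
      else if b (max u v) \<le> min u v \<or> max u v \<le> a (max u v) then 1
      else 1 + nbr_dist b a (min u v) (a (max u v)))"
  by auto
termination
  by (relation "Wellfounded.measure (\<lambda>(b, a, u, v). u + v)") auto

declare nbr_dist.simps [simp del]

lemma nbr_dist_self [simp]: "nbr_dist b a u u = 0"
  by (simp add: nbr_dist.simps)

lemma nbr_dist_sym: "nbr_dist b a u v = nbr_dist b a v u"
  by (subst (1 2) nbr_dist.simps) (simp add: max.commute min.commute)

lemma nbr_dist_pos: "u \<noteq> v \<Longrightarrow> 1 \<le> nbr_dist b a u v"
  by (subst nbr_dist.simps) simp

section \<open>Bounds and monotonicity of \<open>a\<close>, \<open>b\<close> and
  \<open>W\<close>\<close>

locale neighborhood_seq =
  fixes n :: nat and q :: "nat \<Rightarrow> nat" and W :: "nat \<Rightarrow> nat set" and a :: "nat \<Rightarrow> nat"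
  assumes nl: "non_leaping n q"
    and ns: "neighborhood_sequence n q W a"
begin

abbreviation b :: "nat \<Rightarrow> nat" where "b \<equiv> bval q"

abbreviation d :: "nat \<Rightarrow> nat \<Rightarrow> nat" where "d \<equiv> nbr_dist b a"

lemma n_ge_2: "2 \<le> n"
  using nl by (simp add: non_leaping_def)

lemma b_2 [simp]: "b 2 = 2"
  by (simp add: bval_def)

text \<open>The upper bound in \<open>non_leaping\<close> is exactly what makes \<open>b\<close>
  nondecreasing.\<close>

lemma b_step:
  assumes "3 \<le> k" "k \<le> n"
  shows "b (k - 1) \<le> b k"
proof -
  have "q k \<le> q (k - 1) + 1" "q 2 = 1"
    using nl assms by (auto simp: non_leaping_def)
  then show ?thesis using assms by (cases "k = 3") (auto simp: bval_def)
qed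

lemma b_mono:
  assumes "2 \<le> j" "j \<le> k" "k \<le> n"
  shows "b j \<le> b k"
  using assms(2,3)
proof (induction k rule: dec_induct)
  case (step k)
  then show ?case using b_step[of "Suc k"] assms(1) by simp
qed simp

lemma b_ge_2: "2 \<le> k \<Longrightarrow> k \<le> n \<Longrightarrow> 2 \<le> b k"
  using b_mono[of 2 k] by simp

lemma b_less:
  assumes "3 \<le> k" "k \<le> n"
  shows "b k < k"
proof -
  have "2 \<le> q k" using nl assms by (auto simp: non_leaping_def)
  then show ?thesis using assms by (auto simp: bval_def)
qed

lemma a_2 [simp]: "a 2 = 1"
  using ns by (simp add: neighborhood_sequence_def)

lemma a_in: "3 \<le> k \<Longrightarrow> k \<le> n \<Longrightarrow> a k \<in> W (k - 1)"
  using ns by (simp add: neighborhood_sequence_def)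

lemma a_less:
  assumes "2 \<le> k" "k \<le> n"
  shows "a k < b k"
proof (cases "k = 2")
  case False
  then show ?thesis using ns assms by (auto simp: neighborhood_sequence_def)
qed simp

lemma W_1 [simp]: "W (Suc 0) = {}"
  using ns by (simp add: neighborhood_sequence_def)

lemma W_eq:
  assumes "2 \<le> k" "k \<le> n"
  shows "W k = insert (a k) {b k..<k}"
proof (cases "k = 2")
  case True
  then show ?thesis using ns by (simp add: neighborhood_sequence_def)
next
  case False
  then show ?thesis using ns assms by (auto simp: neighborhood_sequence_def)
qed

lemma W_subset:
  assumes "1 \<le> k" "k \<le> n"
  shows "W k \<subseteq> {1..<k}"
  using assms
proof (induction k rule: less_induct)
  case (less k)
  consider "k = 1" | "k = 2" | "3 \<le> k" using less.prems by fastforce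
  then show ?case
  proof cases
    case 3
    then have "W (k - 1) \<subseteq> {1..<k - 1}" using less.prems by (intro less.IH) auto
    then have "a k \<in> {1..<k - 1}" using a_in[of k] 3 less.prems by blast
    then show ?thesis using W_eq[of k] b_ge_2[of k] 3 less.prems by auto
  qed (use W_eq[of 2] n_ge_2 in auto)
qed

lemma W_ge_2: "u \<in> W v \<Longrightarrow> 1 \<le> v \<Longrightarrow> 2 \<le> v"
  by (cases "v = 1") auto

lemma W_bounds: "u \<in> W v \<Longrightarrow> 1 \<le> v \<Longrightarrow> v \<le> n \<Longrightarrow> 1 \<le> u \<and> u < v"
  using W_subset by force

lemma a_in_W: "2 \<le> k \<Longrightarrow> k \<le> n \<Longrightarrow> a k \<in> W k"
  by (simp add: W_eq)

lemma a_bounds: "2 \<le> k \<Longrightarrow> k \<le> n \<Longrightarrow> 1 \<le> a k \<and> a k < k"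
  using W_bounds[OF a_in_W[of k]] by simp

text \<open>If \<open>x\<close> is not \<open>a k\<close>, then
  \<open>b y \<le> b k \<le> x < y\<close> puts \<open>x\<close> into \<open>W y\<close>. If
  \<open>x = a k\<close>, then \<open>a k \<in> W (k - 1)\<close> settles \<open>y = k - 1\<close>,
  and every other \<open>y\<close> lies in \<open>W (k - 1)\<close> because
  \<open>b (k - 1) \<le> b k\<close>, so induction applies.\<close>

lemma W_clique:
  assumes "1 \<le> k" "k \<le> n" "x \<in> W k" "y \<in> W k" "x < y"
  shows "x \<in> W y"
  using assms
proof (induction k rule: less_induct)
  case (less k)
  consider "k = 1" | "k = 2" | "3 \<le> k" using less.prems by fastforce
  then show ?case
  proof cases
    case 3
    have y: "b k \<le> y" "y < k"
      using less.prems W_eq[of k] a_less[of k] 3 by auto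
    then have y2: "2 \<le> y" using b_ge_2[of k] 3 less.prems by simp
    show ?thesis
    proof (cases "x = a k")
      case True
      then have x: "x \<in> W (k - 1)" using a_in 3 less.prems by simp
      show ?thesis
      proof (cases "y = k - 1")
        case False
        then have "y \<in> W (k - 1)"
          using W_eq[of "k - 1"] b_step[of k] y 3 less.prems by auto
        then show ?thesis using less.IH[of "k - 1"] x 3 less.prems by auto
      qed (use x in simp)
    next
      case False
      then have "b y \<le> x"
        using less.prems W_eq[of k] b_mono[of y k] 3 y y2 by auto
      then show ?thesis using W_eq[of y] y y2 less.prems by auto
    qed
  qed (use less.prems W_eq[of 2] in auto)
qed

section \<open>The recursive distance along edges\<close>

lemma d_mem:
  assumes "u \<in> W v" "1 \<le> v" "v \<le> n"
  shows "d u v = 1"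
proof -
  have "u < v" "2 \<le> v" using W_bounds W_ge_2 assms by auto
  \<comment> \<open>If \<open>u = a v\<close> lies below \<open>b v\<close>, the recursion stops
    after one step at \<open>d u u = 0\<close>.\<close>
  moreover have "b v \<le> u \<or> u = a v" using W_eq[of v] assms calculation by auto
  ultimately show ?thesis by (subst nbr_dist.simps) (auto simp: max_def min_def)
qed

lemma d_clique:
  assumes "x \<in> W k" "y \<in> W k" "1 \<le> k" "k \<le> n"
  shows "d x y \<le> 1"
proof -
  consider "x = y" | "x < y" | "y < x" by linarith
  then show ?thesis
  proof cases
    case 2
    then show ?thesis using d_mem[OF W_clique[of k x y]] W_bounds[of y k] assms by simp
  next
    case 3
    then have "d y x = 1" using d_mem[OF W_clique[of k y x]] W_bounds[of x k] assms by simp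
    then show ?thesis by (simp add: nbr_dist_sym)
  qed simp
qed

lemma d_step:
  assumes "u < b v" "u < v" "2 \<le> v" "v \<le> n"
  shows "d u v = 1 + d u (a v)"
  using assms a_bounds[of v] by (subst nbr_dist.simps) (auto simp: max_def min_def)

text \<open>The crucial case is \<open>u < b y\<close>, where \<open>a y\<close> must be at least as close to \<open>u\<close> as any other \<open>x\<close>
  in \<open>W y\<close>: both \<open>a y\<close> and the first vertex \<open>a x\<close> of a shortest path from \<open>x\<close> to \<open>u\<close> lie in the
  clique \<open>W x\<close>.\<close>

lemma d_lipschitz:
  assumes "x \<in> W y" "1 \<le> y" "y \<le> n" "1 \<le> u" "u \<le> n"
  shows "d u x \<le> d u y + 1 \<and> d u y \<le> d u x + 1"
  using assms
\<comment> \<open>This measure drops both when \<open>y\<close> is replaced by a smaller vertex (if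
  \<open>u < y\<close>) and when \<open>u\<close> is replaced by \<open>a u\<close> (if
  \<open>y < u\<close>).\<close>
proof (induction "max u y" arbitrary: u x y rule: less_induct)
  case less
  \<comment> \<open>Two distinct members of a clique \<open>W k\<close> form an edge, the larger one
    in the role of \<open>y\<close>, so the induction hypothesis reaches them in either
    order.\<close>
  have near: "d u' p \<le> d u' r + 1"
    if "p \<in> W k" "r \<in> W k" "1 \<le> k" "k \<le> n" "1 \<le> u'" "u' < max u y" "p < max u y" "r < max u y"
    for p r k u'
  proof -
    have u'n: "u' \<le> n" using that less.prems by simp
    consider "p = r" | "p < r" | "r < p" by linarith
    then show ?thesis
    proof cases
      case 2
      then have "p \<in> W r" using W_clique[of k p r] that by simp
      then show ?thesis using less.hyps[of u' r p] that W_bounds[of r k] u'n by simp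
    next
      case 3
      then have "r \<in> W p" using W_clique[of k r p] that by simp
      then show ?thesis using less.hyps[of u' p r] that W_bounds[of p k] u'n by simp
    qed simp
  qed
  have x: "1 \<le> x" "x < y" "2 \<le> y"
    using W_bounds[of x y] W_ge_2[of x y] less.prems by auto
  consider "u = y" | "u < y" | "y < u" by linarith
  then show ?case
  proof cases
    case 1
    then show ?thesis using d_mem[of x y] less.prems by (simp add: nbr_dist_sym)
  next
    case 2
    show ?thesis
    proof (cases "b y \<le> u")
      case True
      then have "u \<in> W y" using W_eq[of y] 2 x less.prems by simp
      then show ?thesis
        using d_mem[of u y] d_clique[of u y x] less.prems by simp
    next
      case False
      then have dy: "d u y = 1 + d u (a y)" using d_step[of u y] 2 x less.prems by simp
      have ay: "a y \<in> W y" "a y < y" using a_in_W[of y] a_bounds[of y] x less.prems by auto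
      have "d u x \<le> d u (a y) + 1"
        using near[of x y "a y" u] ay x 2 less.prems by simp
      moreover have "d u (a y) \<le> d u x"
      proof (cases "x = a y")
        case False
        then have bx: "b y \<le> x" using W_eq[of y] x less.prems by auto
        then have ayx: "a y < x" "u < x" "2 \<le> x"
          using a_less[of y] b_ge_2[of y] \<open>\<not> b y \<le> u\<close> x less.prems by auto
        then have ayW: "a y \<in> W x" using W_clique[of y "a y" x] ay less.prems by simp
        have xn: "x \<le> n" using x less.prems by simp
        show ?thesis
        proof (cases "b x \<le> u")
          case True
          then have "u \<in> W x" using W_eq[of x] ayx xn by simp
          then have "d u (a y) \<le> 1" using d_clique[of u x "a y"] ayW x xn by simp
          then show ?thesis using nbr_dist_pos[of u x b a] ayx by simp
        next
          case False
          then have "d u x = 1 + d u (a x)" using d_step[of u x] ayx xn by simp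
          moreover have "d u (a y) \<le> d u (a x) + 1"
            using near[of "a y" x "a x" u] ayW a_in_W[of x] a_bounds[of x] ayx x xn ay 2 less.prems
            by simp
          ultimately show ?thesis by simp
        qed
      qed simp
      ultimately show ?thesis using dy by simp
    qed
  next
    case 3
    then have u2: "2 \<le> u" using x by simp
    have au: "a u \<in> W u" "1 \<le> a u" "a u < u" using a_in_W[of u] a_bounds[of u] u2 less.prems by auto
    have stepu: "d u z = 1 + d (a u) z" if "z < u" "z < b u" for z
      using d_step[of z u] that u2 less.prems by (simp add: nbr_dist_sym)
    have memu: "d u z = 1" if "z < u" "b u \<le> z" for z
      using d_mem[of z u] W_eq[of u] that u2 less.prems by (simp add: nbr_dist_sym)
    \<comment> \<open>Either both distances from \<open>u\<close> step down to \<open>a u\<close>,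
      or both equal 1, or \<open>b u\<close> separates \<open>x\<close> from \<open>y\<close>. In
      the last case \<open>d u y = 1\<close>, and \<open>a u\<close> and \<open>x\<close> both lie
      in \<open>W y\<close>, so \<open>d u x\<close> is at most 2.\<close>
    consider "y < b u" | "b u \<le> x" | "b u \<le> y" "x < b u" using x by linarith
    then show ?thesis
    proof cases
      case 1
      have "d (a u) x \<le> d (a u) y + 1 \<and> d (a u) y \<le> d (a u) x + 1"
        using less.hyps[of "a u" y x] au 3 less.prems by simp
      then show ?thesis using stepu 1 x 3 by simp
    next
      case 2
      then show ?thesis using memu x 3 by simp
    next
      case c: 3
      have "y \<in> W u" using W_eq[of u] c 3 u2 less.prems by simp
      then have "a u \<in> W y"
        using W_clique[of u "a u" y] au a_less[of u] c u2 less.prems by simp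
      then have "d (a u) x \<le> 1" using d_clique[of "a u" y x] less.prems by simp
      then show ?thesis using memu[of y] stepu[of x] c x 3 by simp
    qed
  qed
qed

section \<open>Agreement of \<open>d\<close> with the graph distance\<close>

lemma pair_graph: "pair_graph (nbr_graph n W)"
  using nl ns by (rule nbr_graph_pair_graph)

text \<open>By \<open>d_lipschitz\<close>, the value of \<open>d\<close> to the fixed end
  \<open>v\<close> changes by at most 1 along each arc, and it is 0 at \<open>v\<close>.\<close>

lemma d_le_walk:
  assumes "pre_digraph.awalk (with_proj (nbr_graph n W)) u p v"
  shows "d u v \<le> length p"
proof -
  interpret pair_graph "nbr_graph n W" by (rule pair_graph)
  have v: "1 \<le> v" "v \<le> n" using awalk_last_in_verts[OF assms] by (auto simp: nbr_graph_def)
  show ?thesis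
    using assms
  proof (induction p arbitrary: u)
    case (Cons e p)
    obtain x y where e: "e = (x, y)" by (cases e)
    with Cons.prems have arc: "(x, y) \<in> parcs (nbr_graph n W)" and u: "u = x" and p: "awalk y p v"
      by (auto simp: awalk_Cons_iff)
    have "d v x \<le> d v y + 1"
      using arc d_lipschitz[of x y v] d_lipschitz[of y x v] v by (auto simp: nbr_graph_def)
    then show ?case using Cons.IH[OF p] u by (simp add: nbr_dist_sym)
  qed (simp add: awalk_Nil_iff)
qed

text \<open>Unrolling the recursion gives the walk: from the larger end move to \<open>a\<close> of
  it, until the two ends are adjacent or equal.\<close>

lemma walk_of_length_d:
  assumes "1 \<le> u" "u \<le> n" "1 \<le> v" "v \<le> n"
  shows "\<exists>p. pre_digraph.awalk (with_proj (nbr_graph n W)) u p v \<and> length p = d u v"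
proof -
  interpret pair_graph "nbr_graph n W" by (rule pair_graph)
  have sym: "\<exists>p. awalk y p x \<and> length p = l" if "awalk x p y" "length p = l" for x y p l
  proof -
    have "length (rev_path p) = length p" by (induction p) auto
    then show ?thesis using that by (intro exI[of _ "rev_path p"]) simp
  qed
  have arc: "awalk y [(y, x)] x" if "x \<in> W y" "1 \<le> y" "y \<le> n" for x y
  proof -
    have "(y, x) \<in> parcs (nbr_graph n W)" "x \<in> pverts (nbr_graph n W)"
      using that W_bounds[OF that] by (simp_all add: nbr_graph_def)
    then show ?thesis by (simp add: awalk_Cons_iff awalk_Nil_iff)
  qed
  have "\<exists>p. awalk v p u \<and> length p = d u v" if "1 \<le> u" "u \<le> n" "1 \<le> v" "v \<le> n" for u v
    using that
  proof (induction "u + v" arbitrary: u v rule: less_induct)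
    case less
    \<comment> \<open>Fixing only the sum \<open>x + y\<close> lets this serve both orders of
      \<open>u\<close> and \<open>v\<close>; when \<open>v < u\<close> the walk is reversed.\<close>
    have desc: "\<exists>p. awalk y p x \<and> length p = d x y" if "x < y" "x + y = u + v" "1 \<le> x" "y \<le> n" for x y
    proof (cases "x \<in> W y")
      case True
      then show ?thesis using arc[of x y] d_mem[of x y] that by (intro exI[of _ "[(y, x)]"]) auto
    next
      case False
      have y: "2 \<le> y" using that by simp
      then have "x < b y" using False W_eq[of y] \<open>x < y\<close> \<open>y \<le> n\<close> by (simp add: not_le)
      then have dxy: "d x y = 1 + d x (a y)"
        using d_step[of x y] y \<open>x < y\<close> \<open>y \<le> n\<close> by simp
      have "\<exists>p. awalk (a y) p x \<and> length p = d x (a y)"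
      proof -
        have "1 \<le> a y" "a y < y" using a_bounds[of y] y \<open>y \<le> n\<close> by auto
        then have "x + a y < u + v" "a y \<le> n" "x \<le> n" using that by linarith+
        then show ?thesis using less.hyps[of x "a y"] \<open>1 \<le> a y\<close> \<open>1 \<le> x\<close> by blast
      qed
      then obtain p where p: "awalk (a y) p x" "length p = d x (a y)" by blast
      have "awalk y ((y, a y) # p) x"
        using arc[OF a_in_W[of y]] p y \<open>y \<le> n\<close> by (simp add: awalk_Cons_iff)
      then show ?thesis using p dxy by (intro exI[of _ "(y, a y) # p"]) simp
    qed
    consider "u = v" | "u < v" | "v < u" by linarith
    then show ?case
    proof cases
      case 1
      moreover have "v \<in> pverts (nbr_graph n W)" using less.prems by (simp add: nbr_graph_def)
      ultimately show ?thesis by (intro exI[of _ "[]"]) (simp add: awalk_Nil_iff)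
    next
      case 2
      then show ?thesis using desc[OF 2 refl less.prems(1,4)] by simp
    next
      case 3
      then obtain p where "awalk u p v" "length p = d v u"
        using desc[OF 3 add.commute less.prems(3,2)] by blast
      then show ?thesis using sym nbr_dist_sym[of b a u v] by simp
    qed
  qed
  then show ?thesis using assms nbr_dist_sym by metis
qed

lemma graph_dist_eq:
  assumes "1 \<le> u" "u \<le> n" "1 \<le> v" "v \<le> n"
  shows "graph_dist (nbr_graph n W) u v = ereal (d u v)"
proof -
  interpret pair_graph "nbr_graph n W" by (rule pair_graph)
  have cost: "awalk_cost (\<lambda>_. 1) p = length p" for p
    by (induction p) auto
  obtain p where p: "awalk u p v" "length p = d u v"
    using walk_of_length_d assms by blast
  show ?thesis
    unfolding graph_dist_def \<mu>_def
  proof (rule antisym)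
    show "(INF p\<in>{p. awalk u p v}. ereal (awalk_cost (\<lambda>_. 1) p)) \<le> ereal (d u v)"
      using p cost by (intro INF_lower2[of p]) auto
    show "ereal (d u v) \<le> (INF p\<in>{p. awalk u p v}. ereal (awalk_cost (\<lambda>_. 1) p))"
      using d_le_walk cost by (intro INF_greatest) auto
  qed
qed

section \<open>Differences between the distances to \<open>k\<close> and to
  \<open>a k\<close>\<close>

definition delta :: "nat \<Rightarrow> nat \<Rightarrow> real" where
  "delta k j = real (d j k) - real (d j (a k))"

text \<open>Below \<open>b k\<close> this is the recursion for \<open>d\<close>. For
  \<open>b k \<le> j < k\<close>, both \<open>j\<close> and \<open>a k\<close> lie in the clique
  \<open>W k\<close>, so both distances are 1.\<close>

lemma delta_eq:
  assumes "2 \<le> k" "k \<le> n" "j \<le> k"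
  shows "delta k j = of_bool (j < b k) - of_bool (j = k)"
proof -
  consider "j = k" | "j < b k" "j < k" | "b k \<le> j" "j < k" using assms by linarith
  then show ?thesis
  proof cases
    case 1
    have "b k \<le> k" using b_less[of k] assms by (cases "k = 2") auto
    then show ?thesis
      using 1 d_mem[OF a_in_W[of k]] assms by (simp add: delta_def nbr_dist_sym)
  next
    case 2
    then show ?thesis using d_step[of j k] assms by (simp add: delta_def)
  next
    case 3
    then have j: "j \<in> W k" "a k < j" using W_eq[of k] a_less[of k] assms by auto
    then have "a k \<in> W j" using W_clique[of k "a k" j] a_in_W[of k] assms by simp
    then have "d j (a k) = 1" using d_mem[of "a k" j] 3 assms b_ge_2[of k] by (simp add: nbr_dist_sym)
    then show ?thesis using 3 d_mem[OF j(1)] assms by (simp add: delta_def)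
  qed
qed

text \<open>As a member of \<open>W (k - 1)\<close>, \<open>a k\<close> is either
  \<open>a (k - 1)\<close> or in the interval starting at \<open>b (k - 1)\<close>, and
  \<open>a (k - 1)\<close> lies below that interval.\<close>

lemma a_eq_iff:
  assumes "3 \<le> k" "k \<le> n"
  shows "b (k - 1) \<le> a k \<longleftrightarrow> a k \<noteq> a (k - 1)"
proof -
  have pred: "2 \<le> k - 1" "k - 1 \<le> n" using assms by auto
  show ?thesis using a_in[OF assms] W_eq[OF pred] a_less[OF pred] by auto
qed

text \<open>This entry lies just outside the range of \<open>delta_eq\<close> and does depend on the
  choice of \<open>a\<close>; the dependence cancels in the diagonal entries of the product.\<close>

lemma delta_pred:
  assumes "3 \<le> k" "k \<le> n"
  shows "delta (k - 1) k = - of_bool (a k \<noteq> a (k - 1))"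
proof -
  have pred: "2 \<le> k - 1" "k - 1 \<le> n" using assms by auto
  have "k - 1 \<in> W k" using W_eq[of k] b_less[of k] assms by auto
  then have 1: "d k (k - 1) = 1" using d_mem[of "k - 1" k] assms by (simp add: nbr_dist_sym)
  have "a (k - 1) < b k" "a (k - 1) < k"
    using a_less[OF pred] b_step[of k] a_bounds[OF pred] assms by auto
  then have 2: "d k (a (k - 1)) = 1 + d (a (k - 1)) (a k)"
    using d_step[of "a (k - 1)" k] assms by (simp add: nbr_dist_sym)
  have "d (a (k - 1)) (a k) \<le> 1"
    using d_clique[OF a_in_W[OF pred] a_in[of k]] assms by simp
  then have "d (a (k - 1)) (a k) = of_bool (a k \<noteq> a (k - 1))"
    using nbr_dist_pos[of "a (k - 1)" "a k" b a] by (cases "a k = a (k - 1)") auto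
  then show ?thesis using 1 2 by (simp add: delta_def)
qed

lemma delta_diff_less:
  assumes "3 \<le> k" "k \<le> n" "j < k"
  shows "delta k j - delta (k - 1) j = of_bool (b (k - 1) \<le> j \<and> j < b k) + of_bool (j = k - 1)"
  using delta_eq[of k j] delta_eq[of "k - 1" j] b_step[of k] assms by auto

lemma delta_diff_self:
  assumes "3 \<le> k" "k \<le> n"
  shows "delta k k - delta (k - 1) k = of_bool (a k \<noteq> a (k - 1)) - 1"
  using delta_eq[of k k] delta_pred[of k] b_less[of k] assms by auto

section \<open>Reducing the distances in both arguments\<close>

definition reduce :: "nat \<Rightarrow> (nat \<Rightarrow> real) \<Rightarrow> real" where
  "reduce k f = (if k \<le> 2 then f k else f k - f (a k) - f (k - 1) + f (a (k - 1)))"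

lemma reduce_swap: "reduce i (\<lambda>i. reduce j (f i)) = reduce j (\<lambda>j. reduce i (\<lambda>i. f i j))"
  by (simp add: reduce_def)

text \<open>\<open>reduce k\<close> pairs a function on the vertices with column \<open>k\<close> of
  \<open>E\<close>, so the left side is an entry of the congruent matrix. Only
  \<open>i \<le> k\<close> is treated, where \<open>delta\<close> is known; symmetry gives the
  rest.\<close>

lemma reduce_dist_le:
  assumes "1 \<le> i" "i \<le> k" "k \<le> n"
  shows "reduce i (\<lambda>i. reduce k (\<lambda>j. real (d i j))) = reduced_weight q i k"
proof (cases "3 \<le> k")
  case False
  have "d 1 2 = 1" using d_mem[of 1 2] W_eq[of 2] n_ge_2 by simp
  moreover have "(i = 1 \<and> k = 1) \<or> (i = 1 \<and> k = 2) \<or> (i = 2 \<and> k = 2)"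
    using False assms by linarith
  ultimately show ?thesis by (elim disjE conjE) (simp_all add: reduce_def reduced_weight_def upper_weight_def)
next
  case k: True
  define g where "g j = delta k j - delta (k - 1) j" for j
  have g: "reduce k (\<lambda>j. real (d i j)) = g i" for i
    using k by (simp add: reduce_def g_def delta_def)
  have g_less: "g j = of_bool (b (k - 1) \<le> j \<and> j < b k) + of_bool (j = k - 1)" if "j < k" for j
    unfolding g_def using delta_diff_less that k assms by simp
  have mono: "2 \<le> b (k - 1)" "b (k - 1) \<le> b k" "b k < k"
    using b_ge_2[of "k - 1"] b_step[of k] b_less[of k] k assms by auto
  \<comment> \<open>Here \<open>a i < b i \<le> b (k - 1)\<close> and
    \<open>a i < i \<le> k - 1\<close>, so both indicators in \<open>g_less\<close> vanish.\<close>
  have g_a: "g (a i) = 0" if "2 \<le> i" "i < k" for i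
  proof -
    have i: "i \<le> n" "i \<le> k - 1" "k - 1 \<le> n" using that assms by linarith+
    have "a i < k" using a_bounds[OF that(1) i(1)] that by linarith
    moreover have "a i < b (k - 1)" using a_less[OF that(1) i(1)] b_mono[OF that(1) i(2,3)] by linarith
    moreover have "a i \<noteq> k - 1" using a_bounds[OF that(1) i(1)] i by linarith
    ultimately show ?thesis using g_less[of "a i"] by simp
  qed
  consider "i = 1" | "i = 2" | "3 \<le> i" "i < k" | "i = k" using assms by linarith
  then show ?thesis
  proof cases
    case 1
    have "g 1 = 0" using g_less[of 1] k mono(1) by simp
    moreover have "1 \<noteq> b (k - 1)" "1 \<noteq> b k" using mono by linarith+
    ultimately show ?thesis
      using 1 k by (simp only: g) (simp add: reduce_def reduced_weight_def upper_weight_def)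
  next
    case 2
    have "g 2 = of_bool (b (k - 1) \<le> 2 \<and> 2 < b k) + of_bool (2 = k - 1)" using k by (intro g_less) simp
    \<comment> \<open>Since \<open>2 \<le> b (k - 1) \<le> b k\<close>, the point 2 can only be the
      left end of the interval.\<close>
    also have "\<dots> = of_bool (2 = b (k - 1)) - of_bool (2 = b k) + of_bool (2 = k - 1)"
      using mono by (auto simp: of_bool_def)
    finally show ?thesis
      using 2 k by (simp only: g) (simp add: reduce_def reduced_weight_def upper_weight_def)
  next
    case 3
    then have "g (a i) = 0" "g (a (i - 1)) = 0" by (intro g_a; linarith)+
    then have "reduce i g = g i - g (i - 1)" using 3 by (simp add: reduce_def)
    \<comment> \<open>Differencing the indicator of a half-open interval leaves 1 at its left end
      and -1 at its right end. The extra term at \<open>k - 1\<close> enters only through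
      \<open>g i\<close>, as \<open>i - 1 < k - 1\<close>.\<close>
    also have "\<dots> = of_bool (i = b (k - 1)) - of_bool (i = b k) + of_bool (i = k - 1)"
    proof -
      have "g i = of_bool (b (k - 1) \<le> i \<and> i < b k) + of_bool (i = k - 1)"
        using 3 by (intro g_less)
      moreover have "g (i - 1) = of_bool (b (k - 1) \<le> i - 1 \<and> i - 1 < b k) + of_bool (i - 1 = k - 1)"
        using 3 by (intro g_less) linarith
      moreover have "i - 1 \<noteq> k - 1" "b (k - 1) \<le> i - 1 \<longleftrightarrow> b (k - 1) < i" "i - 1 < b k \<longleftrightarrow> i \<le> b k"
        using 3 by linarith+
      ultimately show ?thesis using mono(2) by (auto simp: of_bool_def)
    qed
    finally show ?thesis using 3 k by (simp add: g reduced_weight_def upper_weight_def)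
  next
    case 4
    \<comment> \<open>With \<open>t\<close> for this indicator, the four values combine to
      \<open>(t - 1) - t - 1 + 0 = -2\<close>.\<close>
    have "g k = of_bool (a k \<noteq> a (k - 1)) - 1"
      unfolding g_def using delta_diff_self k assms by simp
    moreover have "g (k - 1) = 1" using g_less[of "k - 1"] mono k by auto
    moreover have "g (a k) = of_bool (a k \<noteq> a (k - 1))"
    proof -
      have pred: "1 \<le> k - 1" "k - 1 \<le> n" and k2: "2 \<le> k" using k assms by linarith+
      have "a k < k - 1" using W_bounds[OF a_in[OF k \<open>k \<le> n\<close>] pred] by simp
      then show ?thesis
        using g_less[of "a k"] a_less[OF k2 \<open>k \<le> n\<close>] a_eq_iff[OF k \<open>k \<le> n\<close>] by simp
    qed
    moreover have "g (a (k - 1)) = 0" using k by (intro g_a) linarith+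
    ultimately show ?thesis using 4 k by (simp only: g) (simp add: reduce_def reduced_weight_def)
  qed
qed

lemma reduce_dist:
  assumes "1 \<le> i" "i \<le> n" "1 \<le> j" "j \<le> n"
  shows "reduce i (\<lambda>i. reduce j (\<lambda>j. real (d i j))) = reduced_weight q i j"
proof (cases "i \<le> j")
  case True
  then show ?thesis using reduce_dist_le assms by simp
next
  case False
  have "reduce i (\<lambda>i. reduce j (\<lambda>j. real (d i j))) = reduce j (\<lambda>j. reduce i (\<lambda>i. real (d j i)))"
    by (subst reduce_swap) (simp add: nbr_dist_sym)
  also have "\<dots> = reduced_weight q j i" using reduce_dist_le False assms by simp
  also have "\<dots> = reduced_weight q i j" using False by (simp add: reduced_weight_def max_def min_def)
  finally show ?thesis .
qed

section \<open>Passage from \<open>reduce\<close> to matrices\<close>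

lemma scalar_prod_reducing_col:
  assumes "v \<in> carrier_vec n" "k < n"
  shows "v \<bullet> col (reducing_matrix n a) k = reduce (Suc k) (\<lambda>i. v $ (i - 1))"
proof -
  define c where "c k = (if k \<le> 2 then std_vec n k
     else std_vec n k - std_vec n (a k) - std_vec n (k - 1) + std_vec n (a (k - 1)))" for k
  have [simp]: "std_vec n i \<in> carrier_vec n" for i by (simp add: std_vec_def)
  have [simp]: "v \<bullet> std_vec n i = v $ (i - 1)" if "1 \<le> i" "i \<le> n" for i
    using that by (simp add: std_vec_def)
  have nth: "map c [1..<Suc n] ! k = c (Suc k)"
    using assms by (subst nth_map) (auto simp del: upt_Suc)
  have "c (Suc k) \<in> carrier_vec n" by (simp add: c_def)
  then have "col (reducing_matrix n a) k = c (Suc k)"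
    unfolding reducing_matrix_def c_def[symmetric] using assms nth
    by (subst col_mat_of_cols) (auto simp del: upt_Suc)
  then have "v \<bullet> col (reducing_matrix n a) k = v \<bullet> c (Suc k)" by simp
  also have "\<dots> = reduce (Suc k) (\<lambda>i. v $ (i - 1))"
  proof (cases "Suc k \<le> 2")
    case False
    then have "1 \<le> a (Suc k)" "a (Suc k) \<le> n" "1 \<le> a k" "a k \<le> n"
      using a_bounds[of "Suc k"] a_bounds[of k] assms by auto
    then show ?thesis
      using False assms
      by (simp add: c_def reduce_def scalar_prod_add_distrib[of _ n] scalar_prod_minus_distrib[of _ n])
  qed (use assms in \<open>simp add: c_def reduce_def\<close>)
  finally show ?thesis .
qed

lemma reducing_matrix_congruence:
  "(reducing_matrix n a)\<^sup>T * dist_matrix n (nbr_graph n W) * reducing_matrix n a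
    = reduced_adj_matrix n q"
proof (rule eq_matI)
  let ?E = "reducing_matrix n a" and ?D = "dist_matrix n (nbr_graph n W)"
  have E: "?E \<in> carrier_mat n n"
    by (rule carrier_matI) (simp_all add: reducing_matrix_def del: upt_Suc)
  have D: "?D \<in> carrier_mat n n" by (simp add: dist_matrix_def)
  \<comment> \<open>\<open>reduce\<close> evaluates its argument only at vertices, and only there do
    the entries of \<open>?D\<close> agree with \<open>d\<close>.\<close>
  have red_cong: "reduce k f = reduce k g" if "\<And>i. 1 \<le> i \<Longrightarrow> i \<le> n \<Longrightarrow> f i = g i" "1 \<le> k" "k \<le> n"
    for k f g
  proof (cases "k \<le> 2")
    case False
    then have "2 \<le> k" "2 \<le> k - 1" "k - 1 \<le> n" using that(3) by linarith+
    then have "1 \<le> a k" "a k \<le> n" "1 \<le> a (k - 1)" "a (k - 1) \<le> n" "1 \<le> k - 1"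
      using a_bounds[of k] a_bounds[of "k - 1"] that(3) by linarith+
    then show ?thesis using False that \<open>k - 1 \<le> n\<close> by (simp only: reduce_def if_False)
  qed (use that in \<open>simp add: reduce_def\<close>)
  fix i j
  assume "i < dim_row (reduced_adj_matrix n q)" "j < dim_col (reduced_adj_matrix n q)"
  then have ij: "i < n" "j < n" by (auto simp: reduced_adj_matrix_def)
  have row: "row ?D r \<bullet> col ?E j = reduce (Suc j) (\<lambda>s. real (d (Suc r) s))" if r: "r < n" for r
  proof -
    have "row ?D r \<bullet> col ?E j = reduce (Suc j) (\<lambda>s. row ?D r $ (s - 1))"
      using D r ij by (intro scalar_prod_reducing_col) auto
    also have "\<dots> = reduce (Suc j) (\<lambda>s. real (d (Suc r) s))"
      using r ij by (intro red_cong) (auto simp: dist_matrix_def graph_dist_eq)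
    finally show ?thesis .
  qed
  have "(?E\<^sup>T * ?D * ?E) $$ (i, j) = (?E\<^sup>T * (?D * ?E)) $$ (i, j)"
    using E D by (subst assoc_mult_mat[of _ n n _ n _ n]) auto
  also have "\<dots> = col ?E i \<bullet> col (?D * ?E) j" using E D ij by simp
  \<comment> \<open>Swapping the factors puts the column of \<open>?E\<close> on the right, so the
    same lemma serves the row reduction.\<close>
  also have "\<dots> = col (?D * ?E) j \<bullet> col ?E i" using E D ij by (intro comm_scalar_prod[of _ n]) auto
  also have "\<dots> = reduce (Suc i) (\<lambda>r. col (?D * ?E) j $ (r - 1))"
    using E D ij by (intro scalar_prod_reducing_col) auto
  also have "\<dots> = reduce (Suc i) (\<lambda>r. reduce (Suc j) (\<lambda>s. real (d r s)))"
    using E D ij row by (intro red_cong) auto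
  also have "\<dots> = reduced_adj_matrix n q $$ (i, j)"
    using reduce_dist ij by (simp add: reduced_adj_matrix_def)
  finally show "(?E\<^sup>T * ?D * ?E) $$ (i, j) = reduced_adj_matrix n q $$ (i, j)" .
qed (simp_all add: reducing_matrix_def reduced_adj_matrix_def del: upt_Suc)

end

theorem theorem2p13:
  fixes n :: nat and q :: "nat \<Rightarrow> nat" and W :: "nat \<Rightarrow> nat set" and a :: "nat \<Rightarrow> nat"
  assumes "non_leaping n q"
    and "neighborhood_sequence n q W a"
  shows "((reducing_matrix n a)\<^sup>T * dist_matrix n (nbr_graph n W) * reducing_matrix n a
           = reduced_adj_matrix n q) \<and>
         (\<forall>W' a'. neighborhood_sequence n q W' a' \<longrightarrow>
           (reducing_matrix n a)\<^sup>T * dist_matrix n (nbr_graph n W) * reducing_matrix n a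
           = (reducing_matrix n a')\<^sup>T * dist_matrix n (nbr_graph n W') * reducing_matrix n a')"
  \<comment> \<open>Both products equal \<open>reduced_adj_matrix n q\<close>, which involves
    neither \<open>W\<close> nor \<open>a\<close>.\<close>
  using assms by (metis neighborhood_seq.intro neighborhood_seq.reducing_matrix_congruence)

end
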